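(* Let $\beta>0$ and let $\gamma:[a,b]\to\mathbb{R}^2$, $\gamma(t)=(f_1(t),f_2(t))$, be a continuous biobjective Pareto front parameterization with $f_1$ nondecreasing and $f_2$ nonincreasing. Then, under the $\ell_1$ norm, the front $\gamma([a,b])$ is isometric to a line interval through $$\phi(t)=\bigl(f_1(t)-f_1(a)\bigr)+\bigl(f_2(a)-f_2(t)\bigr),$$ that is, $\gamma(t)\mapsto\phi(t)$ is a well-defined isometry from $(\gamma([a,b]),\|\cdot\|_1)$ onto the interval $[0,L]$, where $L=\phi(b)$. Therefore, if $L>0$ and $k\geq 2$, the fixed-cardinality Solow--Polasky diversity optimum on the continuous front (the $k$-point subset of $\gamma([a,b])$ maximizing $D_\beta$ under the $\ell_1$ metric) consists of points that are uniformly spaced in $\ell_1$ distance along the front, that is, of points $y_i=\gamma(t_i)$ with $\phi(t_i)=\frac{(i-1)L}{k-1}$, $i=1,\ldots,k$.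
   Context: Solow--Polasky diversity: for $\beta>0$ and a finite subset $S=\{x_1,\ldots,x_k\}$ (with $k$ distinct points) of a metric space $(X,d)$, let $Z_S=\bigl(e^{-\beta d(x_i,x_j)}\bigr)_{i,j=1}^k$; whenever $Z_S$ is nonsingular, $D_\beta(S)=\mathbf{1}^\top Z_S^{-1}\mathbf{1}$, where $\mathbf{1}$ is the all-ones column vector. Here the metric is $d(x,y)=\|x-y\|_1=|x_1-y_1|+|x_2-y_2|$ on $\mathbb{R}^2$. The "biobjective Pareto front parameterization" enters only as a continuous curve $\gamma=(f_1,f_2):[a,b]\to\mathbb{R}^2$ with the stated monotonicity of $f_1$ and $f_2$; no further property of Pareto fronts is assumed. *)

theory Defs
  imports Complex_Main "Jordan_Normal_Form.Determinant"
begin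

definition l1_dist :: "real \<times> real \<Rightarrow> real \<times> real \<Rightarrow> real" where
  "l1_dist x y = \<bar>fst x - fst y\<bar> + \<bar>snd x - snd y\<bar>"

definition isometry_onto ::
  "('a \<Rightarrow> 'a \<Rightarrow> real) \<Rightarrow> 'a set \<Rightarrow> ('b \<Rightarrow> 'b \<Rightarrow> real) \<Rightarrow> 'b set \<Rightarrow> ('a \<Rightarrow> 'b) \<Rightarrow> bool" where
  "isometry_onto d A d' B h \<longleftrightarrow> h ` A = B \<and> (\<forall>x\<in>A. \<forall>y\<in>A. d' (h x) (h y) = d x y)"

definition kernel_mat :: "real \<Rightarrow> ('a \<Rightarrow> 'a \<Rightarrow> real) \<Rightarrow> 'a list \<Rightarrow> real mat" where
  "kernel_mat \<beta> d xs =
     mat (length xs) (length xs) (\<lambda>(i, j). exp (- \<beta> * d (xs ! i) (xs ! j)))"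

(* meaningful only if kernel_mat is invertible; otherwise mat_inverse returns None *)
definition list_diversity :: "real \<Rightarrow> ('a \<Rightarrow> 'a \<Rightarrow> real) \<Rightarrow> 'a list \<Rightarrow> real" where
  "list_diversity \<beta> d xs =
     (let one = vec (length xs) (\<lambda>_. 1)
      in scalar_prod one (the (mat_inverse (kernel_mat \<beta> d xs)) *\<^sub>v one))"

(* An arbitrary enumeration x_1, ..., x_k of a finite set S. By sp_matrix_invertible_iff and
   sp_diversity_eq below, neither nonsingularity nor (in the nonsingular case) the diversity
   depends on which one is chosen. *)
definition enum_set :: "'a set \<Rightarrow> 'a list" where
  "enum_set S = (SOME xs. distinct xs \<and> set xs = S)"

definition sp_matrix :: "real \<Rightarrow> ('a \<Rightarrow> 'a \<Rightarrow> real) \<Rightarrow> 'a set \<Rightarrow> real mat" where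
  "sp_matrix \<beta> d S = kernel_mat \<beta> d (enum_set S)"

definition sp_diversity :: "real \<Rightarrow> ('a \<Rightarrow> 'a \<Rightarrow> real) \<Rightarrow> 'a set \<Rightarrow> real" where
  "sp_diversity \<beta> d S = list_diversity \<beta> d (enum_set S)"

definition sp_optimum :: "real \<Rightarrow> ('a \<Rightarrow> 'a \<Rightarrow> real) \<Rightarrow> 'a set \<Rightarrow> nat \<Rightarrow> 'a set \<Rightarrow> bool" where
  "sp_optimum \<beta> d X k S \<longleftrightarrow>
     is_arg_max (sp_diversity \<beta> d) (\<lambda>T. T \<subseteq> X \<and> finite T \<and> card T = k) S"

lemma enum_set:
  assumes "finite S"
  shows "distinct (enum_set S)" "set (enum_set S) = S"
proof -
  have "\<exists>xs. distinct xs \<and> set xs = S"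
    using finite_distinct_list[OF assms] by blast
  then have "distinct (enum_set S) \<and> set (enum_set S) = S"
    unfolding enum_set_def by (rule someI_ex)
  then show "distinct (enum_set S)" "set (enum_set S) = S" by auto
qed

lemma mat_inverse_eqI:
  fixes A B :: "real mat"
  assumes A: "A \<in> carrier_mat n n" and B: "B \<in> carrier_mat n n" and BA: "B * A = 1\<^sub>m n"
  shows "mat_inverse A = Some B"
proof -
  have AB: "A * B = 1\<^sub>m n"
    using mat_mult_left_right_inverse[OF B A BA] .
  have U: "A \<in> Units (ring_mat TYPE(real) n ())"
    unfolding Units_def ring_mat_def using A B AB BA by auto
  then obtain C where C: "mat_inverse A = Some C"
    using mat_inverse(1)[OF A, of "()"] by (cases "mat_inverse A") auto
  then have AC: "A * C = 1\<^sub>m n" and Cc: "C \<in> carrier_mat n n"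
    using mat_inverse(2)[OF A C] by auto
  have "C = (B * A) * C" using Cc BA by simp
  also have "\<dots> = B * (A * C)" using A B Cc by (simp add: assoc_mult_mat)
  also have "\<dots> = B" using AC B by simp
  finally show ?thesis using C by simp
qed

lemma list_enumeration_cong:
  fixes d :: "'a \<Rightarrow> 'a \<Rightarrow> real"
  assumes dx: "distinct xs" and dy: "distinct ys" and st: "set xs = set ys"
    and inv: "invertible_mat (kernel_mat \<beta> d xs)"
  shows "invertible_mat (kernel_mat \<beta> d ys)"
    and "list_diversity \<beta> d ys = list_diversity \<beta> d xs"
proof -
  define k where "k = length xs"
  have ky: "length ys = k"
    unfolding k_def using dx dy st by (metis distinct_card)
  obtain p where p: "bij_betw p {..<k} {..<k}" and pn: "\<And>i. i < k \<Longrightarrow> ys ! i = xs ! p i"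
  proof -
    define p where "p = (\<lambda>i. the_inv_into {..<k} ((!) xs) (ys ! i))"
    have bx: "bij_betw ((!) xs) {..<k} (set xs)"
      unfolding k_def by (rule bij_betw_nth[OF dx]) auto
    have b: "bij_betw ((!) ys) {..<k} (set xs)"
      unfolding st by (rule bij_betw_nth[OF dy]) (auto simp: ky)
    have "bij_betw (the_inv_into {..<k} ((!) xs) \<circ> ((!) ys)) {..<k} {..<k}"
      using bij_betw_trans[OF b bij_betw_the_inv_into[OF bx]] .
    then have "bij_betw p {..<k} {..<k}" by (simp add: p_def comp_def)
    moreover have "ys ! i = xs ! p i" if "i < k" for i
    proof -
      have "ys ! i \<in> set xs" using that st ky by auto
      then show ?thesis unfolding p_def
        using f_the_inv_into_f_bij_betw[OF bx] by simp
    qed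
    ultimately show ?thesis using that by blast
  qed
  have pk: "p i < k" if "i < k" for i
    using bij_betwE[OF p] that by auto
  have pinj: "p i = p j \<longleftrightarrow> i = j" if "i < k" "j < k" for i j
    using bij_betw_imp_inj_on[OF p] that by (auto dest: inj_onD)
  let ?A = "kernel_mat \<beta> d xs" and ?A' = "kernel_mat \<beta> d ys"
  have A: "?A \<in> carrier_mat k k" and A': "?A' \<in> carrier_mat k k"
    by (simp_all add: kernel_mat_def k_def ky[unfolded k_def])
  from inv obtain B where B1: "?A * B = 1\<^sub>m (dim_row ?A)" and B2: "B * ?A = 1\<^sub>m (dim_row B)"
    unfolding invertible_mat_def inverts_mat_def by blast
  have B: "B \<in> carrier_mat k k"
  proof
    show "dim_col B = k" using arg_cong[OF B1, of dim_col] A by simp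
    show "dim_row B = k" using arg_cong[OF B2, of dim_col] A by simp
  qed
  have BA: "B * ?A = 1\<^sub>m k" using B2 B by simp
  define B' where "B' = mat k k (\<lambda>(i, j). B $$ (p i, p j))"
  have B': "B' \<in> carrier_mat k k" by (simp add: B'_def)
  have BA': "B' * ?A' = 1\<^sub>m k"
  proof (rule eq_matI)
    fix i j assume "i < dim_row (1\<^sub>m k :: real mat)" "j < dim_col (1\<^sub>m k :: real mat)"
    then have ij: "i < k" "j < k" by auto
    have "(B' * ?A') $$ (i, j) = (\<Sum>l<k. B' $$ (i, l) * ?A' $$ (l, j))"
      using ij A' B' by (simp add: scalar_prod_def atLeast0LessThan)
    also have "\<dots> = (\<Sum>l<k. B $$ (p i, p l) * ?A $$ (p l, p j))"
      by (rule sum.cong)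
        (use ij ky pk pn in \<open>auto simp: B'_def kernel_mat_def k_def[symmetric]\<close>)
    also have "\<dots> = (\<Sum>l<k. B $$ (p i, l) * ?A $$ (l, p j))"
      by (rule sum.reindex_bij_betw[OF p])
    also have "\<dots> = (B * ?A) $$ (p i, p j)"
      using pk[OF ij(1)] pk[OF ij(2)] A B by (simp add: scalar_prod_def atLeast0LessThan)
    also have "\<dots> = (1\<^sub>m k) $$ (i, j)"
      unfolding BA using pk ij pinj by auto
    finally show "(B' * ?A') $$ (i, j) = (1\<^sub>m k) $$ (i, j)" .
  qed (use A' B' in auto)
  have AB': "?A' * B' = 1\<^sub>m k"
    using mat_mult_left_right_inverse[OF B' A' BA'] .
  show "invertible_mat ?A'"
    unfolding invertible_mat_def inverts_mat_def square_mat.simps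
    using A' B' BA' AB' by auto
  have sum_entries: "scalar_prod (vec k (\<lambda>_. 1)) (C *\<^sub>v vec k (\<lambda>_. 1)) = (\<Sum>i<k. \<Sum>j<k. C $$ (i, j))"
    if "C \<in> carrier_mat k k" for C :: "real mat"
    using that by (simp add: scalar_prod_def atLeast0LessThan)
  have "list_diversity \<beta> d ys = (\<Sum>i<k. \<Sum>j<k. B' $$ (i, j))"
    by (simp add: list_diversity_def Let_def ky mat_inverse_eqI[OF A' B' BA'] sum_entries[OF B'])
  also have "\<dots> = (\<Sum>i<k. \<Sum>j<k. B $$ (p i, p j))"
    by (simp add: B'_def)
  also have "\<dots> = (\<Sum>i<k. \<Sum>j<k. B $$ (p i, j))"
    by (intro sum.cong refl sum.reindex_bij_betw[OF p])
  also have "\<dots> = (\<Sum>i<k. \<Sum>j<k. B $$ (i, j))"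
    by (rule sum.reindex_bij_betw[OF p])
  also have "\<dots> = list_diversity \<beta> d xs"
    by (simp add: list_diversity_def Let_def k_def[symmetric] mat_inverse_eqI[OF A B BA]
        sum_entries[OF B])
  finally show "list_diversity \<beta> d ys = list_diversity \<beta> d xs" .
qed

lemma sp_matrix_invertible_iff:
  assumes "distinct xs" "set xs = S"
  shows "invertible_mat (sp_matrix \<beta> d S) \<longleftrightarrow> invertible_mat (kernel_mat \<beta> d xs)"
proof -
  have f: "finite S" using assms by auto
  show ?thesis unfolding sp_matrix_def
    using list_enumeration_cong(1)[of "enum_set S" xs \<beta> d]
      list_enumeration_cong(1)[of xs "enum_set S" \<beta> d] assms enum_set[OF f] by auto
qed

lemma sp_diversity_eq:
  assumes "distinct xs" "set xs = S" "invertible_mat (kernel_mat \<beta> d xs)"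
  shows "sp_diversity \<beta> d S = list_diversity \<beta> d xs"
proof -
  have f: "finite S" using assms by auto
  show ?thesis unfolding sp_diversity_def
    using list_enumeration_cong(2)[of xs "enum_set S" \<beta> d] assms enum_set[OF f] by auto
qed

end

theory Submission
  imports Defs
begin

text \<open>
  Both coordinates of the curve are monotone in opposite directions, so the coordinatewise
  increments add up without cancellation and \<open>\<phi>\<close> is the \<open>\<ell>\<^sub>1\<close> arc length. For points
  \<open>u\<^sub>0 < \<dots> < u\<^sub>n\<close> of a line, the exponential kernel has the Markov property
  \<open>exp (- \<beta> (u\<^sub>i - u\<^sub>l)) = exp (- \<beta> (u\<^sub>i - u\<^sub>j)) exp (- \<beta> (u\<^sub>j - u\<^sub>l))\<close> for \<open>u\<^sub>l \<le> u\<^sub>j \<le> u\<^sub>i\<close>,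
  so points can be added one at a time: the kernel matrix stays nonsingular, and a new extreme
  point at distance \<open>g\<close> increases the diversity by \<open>tanh (\<beta> g / 2)\<close>. Hence the diversity is
  \<open>1 + (\<Sum>i. tanh (\<beta> g\<^sub>i / 2))\<close> over the gaps \<open>g\<^sub>i\<close>, whose sum is at most \<open>L\<close>. As \<open>tanh\<close> is
  increasing and strictly concave on the nonnegative reals, the maximum is attained
  exactly when all gaps equal \<open>L / n\<close>.
\<close>

section \<open>The exponential kernel on increasing points of a line\<close>

text \<open>Markov property in matrix form: on the old columns, the row of a new largest point is a
  multiple of the row of its neighbour. Both inductions below rest on this.\<close>

lemma exp_dist_last:
  fixes \<beta> :: real and u :: "nat \<Rightarrow> real"
  assumes "strict_mono_on {..Suc n} u" "j \<le> n"
  shows "exp (- \<beta> * \<bar>u (Suc n) - u j\<bar>) =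
         exp (- \<beta> * (u (Suc n) - u n)) * exp (- \<beta> * \<bar>u n - u j\<bar>)"
proof -
  have "u j \<le> u n" "u n < u (Suc n)"
    using strict_mono_on_imp_mono_on[OF assms(1)] strict_mono_onD[OF assms(1), of n "Suc n"] assms(2)
    by (auto intro: mono_onD)
  then show ?thesis
    by (simp flip: exp_add add: algebra_simps)
qed

text \<open>Subtracting \<open>r\<close> times row \<open>n\<close> from row \<open>n + 1\<close> cancels all columns but the last.\<close>

lemma exp_kernel_trivial:
  fixes \<beta> :: real and u v :: "nat \<Rightarrow> real"
  assumes "\<beta> > 0" "strict_mono_on {..n} u"
    and "\<And>i. i \<le> n \<Longrightarrow> (\<Sum>j\<le>n. exp (- \<beta> * \<bar>u i - u j\<bar>) * v j) = 0"
    and "i \<le> n"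
  shows "v i = 0"
  using assms(2-)
proof (induction n arbitrary: i)
  case 0
  then show ?case by force
next
  case (Suc n)
  define r where "r = exp (- \<beta> * (u (Suc n) - u n))"
  have lt: "u n < u (Suc n)"
    using strict_mono_onD[OF Suc.prems(1), of n "Suc n"] by simp
  have r: "0 < r" "r < 1"
    unfolding r_def using lt assms(1) by auto
  have "(\<Sum>j\<le>n. exp (- \<beta> * \<bar>u (Suc n) - u j\<bar>) * v j) =
      r * (\<Sum>j\<le>n. exp (- \<beta> * \<bar>u n - u j\<bar>) * v j)"
    unfolding sum_distrib_left r_def
    by (intro sum.cong refl) (simp only: exp_dist_last[OF Suc.prems(1)] atMost_iff mult.assoc)
  moreover have "(\<Sum>j\<le>n. exp (- \<beta> * \<bar>u n - u j\<bar>) * v j) = - (r * v (Suc n))"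
    using Suc.prems(2)[of n] lt by (simp add: r_def algebra_simps)
  moreover have "(\<Sum>j\<le>n. exp (- \<beta> * \<bar>u (Suc n) - u j\<bar>) * v j) = - v (Suc n)"
    using Suc.prems(2)[of "Suc n"] by simp
  ultimately have "(1 - r * r) * v (Suc n) = 0"
    by (simp add: algebra_simps)
  moreover have "r * r < 1"
    using r mult_strict_mono[of r 1 r 1] by simp
  ultimately have last: "v (Suc n) = 0" by simp
  \<comment> \<open>A vanishing last entry removes the last column, so the first
    \<open>n + 1\<close> rows are the system of the induction hypothesis.\<close>
  have "v i = 0" if "i \<le> n" for i
  proof (rule Suc.IH[OF _ _ that])
    show "strict_mono_on {..n} u"
      using Suc.prems(1) by (rule monotone_on_subset) auto
    show "(\<Sum>j\<le>n. exp (- \<beta> * \<bar>u i - u j\<bar>) * v j) = 0" if "i \<le> n" for i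
      using Suc.prems(2)[of i] that last by simp
  qed
  then show ?case
    using last Suc.prems(3) le_Suc_eq by auto
qed

text \<open>With \<open>r = exp (- x)\<close> this is \<open>(1 - r) / (1 + r)\<close>, the form in
  which the weighting below produces its increment.\<close>

lemma tanh_half_eq:
  fixes x :: real
  shows "tanh (x / 2) = (1 - exp (- x)) / (1 + exp (- x))"
  using tanh_real_altdef[of "x / 2"] by simp

text \<open>
  The weight of the new point is \<open>1 / (1 + r)\<close>, and \<open>r\<close> times it is taken away from its neighbour,
  so that the old rows do not see the change.
\<close>

lemma exp_kernel_weighting:
  fixes \<beta> :: real and u :: "nat \<Rightarrow> real"
  assumes "strict_mono_on {..n} u"
  shows "\<exists>w. (\<forall>i\<le>n. (\<Sum>j\<le>n. exp (- \<beta> * \<bar>u i - u j\<bar>) * w j) = 1) \<and>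
             (\<Sum>j\<le>n. w j) = 1 + (\<Sum>i<n. tanh (\<beta> * (u (Suc i) - u i) / 2))"
  using assms
proof (induction n)
  case 0
  then show ?case by (intro exI[of _ "\<lambda>_. 1"]) simp
next
  case (Suc n)
  have "strict_mono_on {..n} u"
    using Suc.prems by (rule monotone_on_subset) auto
  from Suc.IH[OF this] obtain w
    where w: "\<And>i. i \<le> n \<Longrightarrow> (\<Sum>j\<le>n. exp (- \<beta> * \<bar>u i - u j\<bar>) * w j) = 1"
      and ws: "(\<Sum>j\<le>n. w j) = 1 + (\<Sum>i<n. tanh (\<beta> * (u (Suc i) - u i) / 2))"
    by blast
  define r where "r = exp (- \<beta> * (u (Suc n) - u n))"
  have r: "0 < r" unfolding r_def by simp
  have lt: "u n < u (Suc n)"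
    using strict_mono_onD[OF Suc.prems, of n "Suc n"] by simp
  define w' where "w' j = (if j = Suc n then 1 / (1 + r)
    else w j - (if j = n then r / (1 + r) else 0))" for j
  \<comment> \<open>The coefficients \<open>c\<close> stay free so that one identity serves the
    kernel rows and, with constant value 1, the total weight.\<close>
  have split: "(\<Sum>j\<le>n. c j * w' j) = (\<Sum>j\<le>n. c j * w j) - c n * (r / (1 + r))" for c :: "nat \<Rightarrow> real"
  proof -
    have "(\<Sum>j\<le>n. c j * w' j) = (\<Sum>j\<le>n. c j * w j - (if j = n then c n * (r / (1 + r)) else 0))"
      by (intro sum.cong refl) (auto simp: w'_def algebra_simps)
    then show ?thesis by (simp add: sum_subtractf)
  qed
  have rows: "(\<Sum>j\<le>n. exp (- \<beta> * \<bar>u i - u j\<bar>) * w' j) = 1 - exp (- \<beta> * \<bar>u i - u n\<bar>) * (r / (1 + r))"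
    if "i \<le> n" for i
    using split[of "\<lambda>j. exp (- \<beta> * \<bar>u i - u j\<bar>)"] w[OF that] by simp
  have "(\<Sum>j\<le>Suc n. exp (- \<beta> * \<bar>u i - u j\<bar>) * w' j) = 1" if "i \<le> Suc n" for i
  proof (cases "i = Suc n")
    case True
    \<comment> \<open>By \<open>rows\<close>, the old columns give \<open>1 / (1 + r)\<close> in row
      \<open>n\<close>, hence \<open>r / (1 + r)\<close> here; the new weight supplies the missing
      \<open>1 / (1 + r)\<close>.\<close>
    have "(\<Sum>j\<le>n. exp (- \<beta> * \<bar>u (Suc n) - u j\<bar>) * w' j) =
        r * (\<Sum>j\<le>n. exp (- \<beta> * \<bar>u n - u j\<bar>) * w' j)"
      unfolding sum_distrib_left r_def
      by (intro sum.cong refl) (simp only: exp_dist_last[OF Suc.prems] atMost_iff mult.assoc)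
    also have "\<dots> = r * (1 - r / (1 + r))"
      using rows[of n] by simp
    finally show ?thesis
      using True r by (simp add: w'_def[of "Suc n"] field_simps)
  next
    case False
    with that have i: "i \<le> n" by simp
    \<comment> \<open>In an old row the new column is \<open>r\<close> times column
      \<open>n\<close>, so the new weight returns exactly what column \<open>n\<close> lost.\<close>
    then have "exp (- \<beta> * \<bar>u i - u (Suc n)\<bar>) = r * exp (- \<beta> * \<bar>u i - u n\<bar>)"
      using exp_dist_last[OF Suc.prems i, of \<beta>] by (simp add: r_def abs_minus_commute)
    then show ?thesis
      using rows[OF i] by (simp add: w'_def[of "Suc n"])
  qed
  moreover have "(\<Sum>j\<le>Suc n. w' j) = 1 + (\<Sum>i<Suc n. tanh (\<beta> * (u (Suc i) - u i) / 2))"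
  proof -
    have "tanh (\<beta> * (u (Suc n) - u n) / 2) = 1 / (1 + r) - r / (1 + r)"
      by (simp add: tanh_half_eq r_def diff_divide_distrib)
    then show ?thesis
      using split[of "\<lambda>_. 1"] ws by (simp add: w'_def[of "Suc n"])
  qed
  ultimately show ?case by blast
qed

section \<open>Nonsingularity and the value of the diversity\<close>

text \<open>The kernel matrix sends the weighting to the all-ones vector, so its inverse sends that
  vector back and the diversity is the total weight. Only distances enter, so the points may lie in
  any space.\<close>

lemma kernel_mat_path:
  fixes d :: "'a \<Rightarrow> 'a \<Rightarrow> real"
  assumes "\<beta> > 0" "strict_mono_on {..n} u" and len: "length xs = Suc n"
    and d: "\<And>i j. i \<le> n \<Longrightarrow> j \<le> n \<Longrightarrow> d (xs ! i) (xs ! j) = \<bar>u i - u j\<bar>"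
  shows "invertible_mat (kernel_mat \<beta> d xs)"
    and "list_diversity \<beta> d xs = 1 + (\<Sum>i<n. tanh (\<beta> * (u (Suc i) - u i) / 2))"
proof -
  let ?A = "kernel_mat \<beta> d xs"
  have A: "?A \<in> carrier_mat (Suc n) (Suc n)"
    by (simp add: kernel_mat_def len)
  have mult: "(?A *\<^sub>v v) $ i = (\<Sum>j\<le>n. exp (- \<beta> * \<bar>u i - u j\<bar>) * v $ j)"
    if "i \<le> n" "v \<in> carrier_vec (Suc n)" for i v
    using that by (auto simp: kernel_mat_def len scalar_prod_def d lessThan_Suc_atMost
        atLeast0LessThan intro!: sum.cong)
  have "det ?A \<noteq> 0"
  proof
    assume "det ?A = 0"
    then obtain v where v: "v \<in> carrier_vec (Suc n)" "v \<noteq> 0\<^sub>v (Suc n)" "?A *\<^sub>v v = 0\<^sub>v (Suc n)"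
      using det_0_iff_vec_prod_zero[OF A] by blast
    have "(\<Sum>j\<le>n. exp (- \<beta> * \<bar>u i - u j\<bar>) * v $ j) = 0" if "i \<le> n" for i
      using mult[OF that v(1)] that by (simp add: v(3))
    then have "v $ i = 0" if "i \<le> n" for i
      using exp_kernel_trivial[OF assms(1,2), of "\<lambda>j. v $ j" i] that by blast
    then have "v = 0\<^sub>v (Suc n)"
      using v(1) by (intro eq_vecI) auto
    with v(2) show False by simp
  qed
  then have "?A \<in> Units (ring_mat TYPE(real) (Suc n) ())"
    by (rule det_non_zero_imp_unit[OF A])
  then obtain B where B: "B \<in> carrier_mat (Suc n) (Suc n)"
    and AB: "?A * B = 1\<^sub>m (Suc n)" and BA: "B * ?A = 1\<^sub>m (Suc n)"
    by (auto simp: Units_def ring_mat_def)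
  then show "invertible_mat ?A"
    using A unfolding invertible_mat_def inverts_mat_def square_mat.simps by auto
  obtain w where w: "\<And>i. i \<le> n \<Longrightarrow> (\<Sum>j\<le>n. exp (- \<beta> * \<bar>u i - u j\<bar>) * w j) = 1"
    and ws: "(\<Sum>j\<le>n. w j) = 1 + (\<Sum>i<n. tanh (\<beta> * (u (Suc i) - u i) / 2))"
    using exp_kernel_weighting[OF assms(2), of \<beta>] by blast
  let ?one = "vec (Suc n) (\<lambda>_. 1) :: real vec" and ?w = "vec (Suc n) w"
  have "?A *\<^sub>v ?w = ?one"
  proof (rule eq_vecI)
    fix i assume "i < dim_vec ?one"
    then have i: "i \<le> n" by simp
    have "(?A *\<^sub>v ?w) $ i = (\<Sum>j\<le>n. exp (- \<beta> * \<bar>u i - u j\<bar>) * w j)"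
      by (simp add: mult[OF i])
    then show "(?A *\<^sub>v ?w) $ i = ?one $ i"
      using w[OF i] i by simp
  qed (use A in auto)
  then have "B *\<^sub>v ?one = (B * ?A) *\<^sub>v ?w"
    using A B by simp
  also have "\<dots> = ?w"
    using BA by simp
  finally have Bone: "B *\<^sub>v ?one = ?w" .
  have "list_diversity \<beta> d xs = scalar_prod ?one ?w"
    using mat_inverse_eqI[OF A B BA] Bone by (simp add: list_diversity_def len)
  also have "\<dots> = (\<Sum>j\<le>n. w j)"
    by (simp add: scalar_prod_def atLeast0LessThan lessThan_Suc_atMost)
  finally show "list_diversity \<beta> d xs = 1 + (\<Sum>i<n. tanh (\<beta> * (u (Suc i) - u i) / 2))"
    using ws by simp
qed

section \<open>Concavity of \<open>tanh\<close> and the best gaps\<close>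

text \<open>The derivative \<open>1 - (tanh z)\<^sup>2\<close> decreases strictly on the nonnegative
  reals; the mean value theorem compares it at an intermediate point with its value at
  \<open>c\<close>.\<close>

lemma tanh_less_tangent:
  fixes x c :: real
  assumes "0 \<le> x" "0 \<le> c" "x \<noteq> c"
  shows "tanh x < tanh c + (1 - (tanh c)\<^sup>2) * (x - c)"
proof -
  have deriv: "(tanh has_real_derivative 1 - (tanh z)\<^sup>2) (at z)" for z :: real
    by (auto intro!: derivative_eq_intros)
  show ?thesis
  proof (cases "x < c")
    case True
    then obtain z where z: "x < z" "z < c" "tanh c - tanh x = (c - x) * (1 - (tanh z)\<^sup>2)"
      using MVT2[of x c tanh "\<lambda>z. 1 - (tanh z)\<^sup>2"] deriv by blast
    then have "(tanh z)\<^sup>2 < (tanh c)\<^sup>2"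
      using assms by (intro power_strict_mono) auto
    then have "(c - x) * (tanh z)\<^sup>2 < (c - x) * (tanh c)\<^sup>2"
      using True by simp
    then show ?thesis using z(3) by (simp add: algebra_simps)
  next
    case False
    with assms have "c < x" by simp
    then obtain z where z: "c < z" "z < x" "tanh x - tanh c = (x - c) * (1 - (tanh z)\<^sup>2)"
      using MVT2[of c x tanh "\<lambda>z. 1 - (tanh z)\<^sup>2"] deriv by blast
    then have "(tanh c)\<^sup>2 < (tanh z)\<^sup>2"
      using assms by (intro power_strict_mono) auto
    then have "(x - c) * (tanh c)\<^sup>2 < (x - c) * (tanh z)\<^sup>2"
      using \<open>c < x\<close> by simp
    then show ?thesis using z(3) by (simp add: algebra_simps)
  qed
qed

text \<open>Jensen's inequality by means of the tangent at the uniform gap; strictness of the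
  tangent bound settles the equality case.\<close>

lemma sum_tanh_gaps:
  fixes \<beta> L :: real and u :: "nat \<Rightarrow> real"
  assumes "\<beta> > 0" "L \<ge> 0" "n > 0" "mono_on {..n} u" "0 \<le> u 0" "u n \<le> L"
  defines "M \<equiv> real n * tanh (\<beta> * (L / n) / 2)"
  shows "(\<Sum>i<n. tanh (\<beta> * (u (Suc i) - u i) / 2)) \<le> M"
    and "(\<Sum>i<n. tanh (\<beta> * (u (Suc i) - u i) / 2)) = M \<longleftrightarrow> (\<forall>i\<le>n. u i = i * L / n)"
proof -
  \<comment> \<open>\<open>c\<close> is the argument of \<open>tanh\<close> for the uniform gap;
    \<open>T i\<close> is the value at \<open>g i\<close> of the tangent at \<open>c\<close>, whose
    slope is \<open>s\<close>.\<close>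
  define c where "c = \<beta> * (L / n) / 2"
  define s where "s = 1 - (tanh c)\<^sup>2"
  define g where "g i = \<beta> * (u (Suc i) - u i) / 2" for i
  define T where "T i = tanh c + s * (g i - c)" for i
  have c: "0 \<le> c" unfolding c_def using assms by simp
  have s: "0 \<le> s"
    unfolding s_def using tanh_real_bounds[of c] by (simp add: abs_square_le_1 abs_le_iff less_imp_le)
  have g: "0 \<le> g i" if "i < n" for i
    unfolding g_def using assms(1) mono_onD[OF assms(4), of i "Suc i"] that by simp
  have less: "tanh (g i) < T i" if "i < n" "g i \<noteq> c" for i
    unfolding T_def s_def using tanh_less_tangent[OF g[OF that(1)] c that(2)] .
  have le: "tanh (g i) \<le> T i" if "i < n" for i
    using less[OF that] by (cases "g i = c") (auto simp: T_def)
  have "(\<Sum>i<n. g i) = \<beta> * (u n - u 0) / 2"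
    unfolding g_def by (simp add: sum_lessThan_telescope flip: sum_divide_distrib sum_distrib_left)
  also have "\<dots> \<le> \<beta> * L / 2"
    using assms by simp
  also have "\<dots> = real n * c"
    using assms(3) by (simp add: c_def)
  \<comment> \<open>The points may leave room at the ends, so the sum of the gaps is only bounded
    above; the nonnegative slope preserves this bound.\<close>
  finally have "s * ((\<Sum>i<n. g i) - real n * c) \<le> 0"
    using s by (simp add: mult_nonneg_nonpos)
  moreover have "(\<Sum>i<n. T i) = M + s * ((\<Sum>i<n. g i) - real n * c)"
    by (simp add: T_def sum.distrib sum_subtractf M_def c_def flip: sum_distrib_left)
  ultimately have TM: "(\<Sum>i<n. T i) \<le> M" by simp
  show "(\<Sum>i<n. tanh (\<beta> * (u (Suc i) - u i) / 2)) \<le> M"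
    using sum_mono[of "{..<n}" "\<lambda>i. tanh (g i)" T] le TM unfolding g_def by auto
  show "(\<Sum>i<n. tanh (\<beta> * (u (Suc i) - u i) / 2)) = M \<longleftrightarrow> (\<forall>i\<le>n. u i = i * L / n)"
  proof
    assume eq: "(\<Sum>i<n. tanh (\<beta> * (u (Suc i) - u i) / 2)) = M"
    \<comment> \<open>A single gap away from the point of tangency would make the summed tangent
      bound strict.\<close>
    have "g i = c" if "i < n" for i
    proof (rule ccontr)
      assume "g i \<noteq> c"
      then have "(\<Sum>i<n. tanh (g i)) < (\<Sum>i<n. T i)"
        using le less that by (intro sum_strict_mono_ex1) auto
      with eq TM show False unfolding g_def by simp
    qed
    then have step: "u (Suc i) = u i + L / n" if "i < n" for i
    proof -
      have "\<beta> * (u (Suc i) - u i) = \<beta> * (L / n)"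
        using \<open>\<And>i. i < n \<Longrightarrow> g i = c\<close>[OF that] by (simp add: g_def c_def)
      then have "u (Suc i) - u i = L / n"
        using assms(1) by (simp only: mult_cancel_left) simp
      then show ?thesis by simp
    qed
    have *: "u i = u 0 + i * (L / n)" if "i \<le> n" for i
      using that by (induction i) (auto simp: step algebra_simps add_divide_distrib)
    \<comment> \<open>The \<open>n\<close> gaps of length \<open>L / n\<close> already fill the
      segment, so the first point must be its left end.\<close>
    then have "u 0 = 0"
    proof -
      have "real n * (L / n) = L"
        using assms(3) by simp
      then show ?thesis
        using *[OF order_refl] assms(5,6) by linarith
    qed
    then show "\<forall>i\<le>n. u i = i * L / n"
      using * by (metis add_0 times_divide_eq_right)
  next
    assume "\<forall>i\<le>n. u i = i * L / n"
    then have "u (Suc i) - u i = L / n" if "i < n" for i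
      using that by (simp add: field_simps)
    then show "(\<Sum>i<n. tanh (\<beta> * (u (Suc i) - u i) / 2)) = M"
      by (simp add: M_def)
  qed
qed

section \<open>Point sets in a space isometric to a segment\<close>

text \<open>Sorting the image under \<open>h\<close> turns \<open>T\<close> into an increasing
  sequence in the segment, to which the diversity formula and the gap bound apply.\<close>

lemma isometry_segment_diversity:
  fixes d :: "'a \<Rightarrow> 'a \<Rightarrow> real" and L :: real
  assumes iso: "isometry_onto d X dist {0..L} h" and inj: "inj_on h X"
    and \<beta>: "\<beta> > 0" and "L > 0" "n > 0"
    and T: "T \<subseteq> X" "finite T" "card T = Suc n"
  defines "M \<equiv> 1 + real n * tanh (\<beta> * (L / n) / 2)"
  shows "invertible_mat (sp_matrix \<beta> d T)"
    and "sp_diversity \<beta> d T \<le> M"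
    and "sp_diversity \<beta> d T = M \<longleftrightarrow> h ` T = (\<lambda>i. real i * L / real n) ` {..n}"
proof -
  define us where "us = sorted_list_of_set (h ` T)"
  define u where "u i = us ! i" for i
  define xs where "xs = map (inv_into X h) us"
  have hX: "h ` X = {0..L}" and dh: "\<And>x y. x \<in> X \<Longrightarrow> y \<in> X \<Longrightarrow> d x y = \<bar>h x - h y\<bar>"
    using iso unfolding isometry_onto_def dist_real_def by auto
  have set_us: "set us = h ` T"
    using T by (simp add: us_def)
  have len: "length us = Suc n"
    using T inj_on_subset[OF inj] by (simp add: us_def card_image)
  have strict: "strict_mono_on {..n} u"
    using strict_sorted_list_of_set[of "h ` T"] len
    by (auto simp: u_def us_def sorted_wrt_iff_nth_less intro!: strict_mono_onI)
  have u_img: "u ` {..n} = h ` T"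
    using len unfolding set_us[symmetric] set_conv_nth u_def by (auto simp: less_Suc_eq_le)
  have u_in: "u i \<in> {0..L}" "u i \<in> h ` X" if "i \<le> n" for i
    using u_img hX T(1) that by blast+
  have xs: "distinct xs" "set xs = T"
  proof -
    show "set xs = T"
      unfolding xs_def using set_us T(1) inj by (auto simp: image_image subset_iff)
    show "distinct xs"
      unfolding xs_def distinct_map using set_us hX T(1)
      by (auto simp: us_def intro!: inj_on_subset[OF inj_on_inv_into])
  qed
  have d: "d (xs ! i) (xs ! j) = \<bar>u i - u j\<bar>" if "i \<le> n" "j \<le> n" for i j
    using that len u_in(2)[of i] u_in(2)[of j]
    by (simp add: xs_def u_def[symmetric] dh inv_into_into f_inv_into_f)
  have len': "length xs = Suc n" by (simp add: xs_def len)
  note path = kernel_mat_path[OF \<beta> strict len' d]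
  show "invertible_mat (sp_matrix \<beta> d T)"
    using path(1) sp_matrix_invertible_iff[OF xs] by simp
  have div: "sp_diversity \<beta> d T = 1 + (\<Sum>i<n. tanh (\<beta> * (u (Suc i) - u i) / 2))"
    using path(2) sp_diversity_eq[OF xs path(1)] by simp
  have "L \<ge> 0" "0 \<le> u 0" "u n \<le> L" using \<open>L > 0\<close> u_in(1)[of 0] u_in(1)[of n] by auto
  note gaps = sum_tanh_gaps[OF \<beta> this(1) \<open>n > 0\<close> strict_mono_on_imp_mono_on[OF strict] this(2,3)]
  show "sp_diversity \<beta> d T \<le> M"
    using gaps(1) by (simp add: div M_def)
  have "h ` T = (\<lambda>i. real i * L / real n) ` {..n} \<longleftrightarrow> (\<forall>i\<le>n. u i = i * L / n)"
  proof
    \<comment> \<open>A finite set of reals has only one strictly increasing enumeration, so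
      equality of the sets gives equality term by term.\<close>
    define q where "q i = i * L / n" for i :: nat
    have "strict_mono q"
      using \<open>L > 0\<close> \<open>n > 0\<close> by (auto simp: strict_mono_def q_def divide_simps)
    moreover have "sorted_wrt (<) (map q [0..<Suc n])"
      using \<open>strict_mono q\<close> by (simp add: sorted_wrt_map strict_mono_less del: upt_Suc)
    moreover assume "h ` T = (\<lambda>i. real i * L / real n) ` {..n}"
    ultimately have "map q [0..<Suc n] = us"
      unfolding us_def by (intro strict_sorted_equal) (auto simp: q_def atLeast0LessThan lessThan_Suc_atMost simp del: upt_Suc)
    then show "\<forall>i\<le>n. u i = i * L / n"
      unfolding u_def q_def by (auto simp del: upt_Suc)
  next
    assume "\<forall>i\<le>n. u i = i * L / n"
    then show "h ` T = (\<lambda>i. real i * L / real n) ` {..n}"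
      unfolding u_img[symmetric] by (intro image_cong) auto
  qed
  then show "sp_diversity \<beta> d T = M \<longleftrightarrow> h ` T = (\<lambda>i. real i * L / real n) ` {..n}"
    using gaps(2) by (simp add: div M_def)
qed

text \<open>The uniform grid lies in the segment, so its preimage attains the bound; the optima are
  then exactly the sets in the equality case.\<close>

lemma isometry_segment_sp_optimum:
  fixes d :: "'a \<Rightarrow> 'a \<Rightarrow> real" and L :: real
  assumes iso: "isometry_onto d X dist {0..L} h" and inj: "inj_on h X"
    and "\<beta> > 0" "L > 0" "n > 0"
  shows "sp_optimum \<beta> d X (Suc n) S \<longleftrightarrow> S \<subseteq> X \<and> h ` S = (\<lambda>i. real i * L / real n) ` {..n}"
proof -
  let ?Q = "(\<lambda>i. real i * L / real n) ` {..n}"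
  define M where "M = 1 + real n * tanh (\<beta> * (L / n) / 2)"
  note bound = isometry_segment_diversity[OF iso inj assms(3-5), folded M_def]
  have Q: "card ?Q = Suc n" "finite ?Q" "?Q \<subseteq> h ` X"
  proof -
    have "inj_on (\<lambda>i. real i * L / real n) {..n}"
      using \<open>L > 0\<close> \<open>n > 0\<close> by (simp add: inj_on_def)
    then show "card ?Q = Suc n" by (simp add: card_image)
    show "?Q \<subseteq> h ` X"
    proof (rule image_subsetI)
      fix i assume "i \<in> {..n}"
      then have "real i * L \<le> real n * L"
        using \<open>L > 0\<close> by (intro mult_right_mono) auto
      then show "real i * L / real n \<in> h ` X"
        using iso \<open>L > 0\<close> \<open>n > 0\<close> by (simp add: isometry_onto_def divide_le_eq mult.commute)
    qed
  qed simp
  have unif: "finite R \<and> card R = Suc n" if "R \<subseteq> X" "h ` R = ?Q" for R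
  proof -
    have "inj_on h R"
      using inj that(1) by (rule inj_on_subset)
    then show ?thesis
      using card_image[of h R] finite_imageD[of h R] that(2) Q(1,2) by simp
  qed
  \<comment> \<open>This preimage of the grid is the competitor that every optimum has to
    match.\<close>
  obtain R where R: "R \<subseteq> X" "h ` R = ?Q"
    using Q(3) unfolding subset_image_iff by blast
  have RM: "sp_diversity \<beta> d R = M"
    using bound(3)[of R] R unif[OF R] by simp
  show ?thesis
  proof
    assume "sp_optimum \<beta> d X (Suc n) S"
    then have S: "S \<subseteq> X" "finite S" "card S = Suc n" "\<not> sp_diversity \<beta> d S < sp_diversity \<beta> d R"
      using R(1) unif[OF R] unfolding sp_optimum_def is_arg_max_def by blast+
    then have "sp_diversity \<beta> d S = M"
      using RM bound(2)[OF S(1-3)] by linarith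
    then show "S \<subseteq> X \<and> h ` S = ?Q"
      using S(1) bound(3)[OF S(1-3)] by blast
  next
    assume S: "S \<subseteq> X \<and> h ` S = ?Q"
    then have S': "S \<subseteq> X" "finite S" "card S = Suc n"
      using unif by blast+
    then have "sp_diversity \<beta> d S = M"
      using S bound(3)[OF S'] by blast
    then show "sp_optimum \<beta> d X (Suc n) S"
      using S' bound(2) unfolding sp_optimum_def is_arg_max_def by (metis not_less)
  qed
qed

section \<open>Transfer to the front\<close>

theorem corollary1:
  fixes \<beta> a b L :: real
    and f1 f2 \<phi> :: "real \<Rightarrow> real"
    and \<gamma> :: "real \<Rightarrow> real \<times> real"
  assumes "\<beta> > 0"
    and "a \<le> b"
    and "\<gamma> = (\<lambda>t. (f1 t, f2 t))"
    and "continuous_on {a..b} \<gamma>"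
    and "mono_on {a..b} f1"
    and "antimono_on {a..b} f2"
    and "\<phi> = (\<lambda>t. (f1 t - f1 a) + (f2 a - f2 t))"
    and "L = \<phi> b"
  shows "(\<exists>h. (\<forall>t\<in>{a..b}. h (\<gamma> t) = \<phi> t) \<and>
              isometry_onto l1_dist (\<gamma> ` {a..b}) dist {0..L} h) \<and>
         (L > 0 \<longrightarrow> (\<forall>k\<ge>2.
            (\<forall>T. T \<subseteq> \<gamma> ` {a..b} \<and> finite T \<and> card T = k \<longrightarrow>
                 invertible_mat (sp_matrix \<beta> l1_dist T)) \<and>
            (\<exists>!S. sp_optimum \<beta> l1_dist (\<gamma> ` {a..b}) k S) \<and>
            (\<forall>S. sp_optimum \<beta> l1_dist (\<gamma> ` {a..b}) k S \<longleftrightarrow>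
                 (\<exists>t. (\<forall>i\<in>{1..k}. t i \<in> {a..b} \<and>
                                    \<phi> (t i) = (real i - 1) * L / (real k - 1)) \<and>
                      S = (\<lambda>i. \<gamma> (t i)) ` {1..k}))))"
proof -
  define X where "X = \<gamma> ` {a..b}"
  \<comment> \<open>Written in the coordinates of the point, \<open>h\<close> cannot depend on the
    parameter that represents it; this is well-definedness.\<close>
  define h where "h p = (fst p - f1 a) + (f2 a - snd p)" for p
  have h\<gamma>: "h (\<gamma> t) = \<phi> t" for t
    by (simp add: h_def assms(3,7))
  \<comment> \<open>For \<open>s \<le> t\<close> both coordinate contributions to the change of
    \<open>\<phi>\<close> have the same sign, so their absolute values add up.\<close>
  have dist_le: "\<bar>\<phi> s - \<phi> t\<bar> = l1_dist (\<gamma> s) (\<gamma> t)"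
    if "s \<in> {a..b}" "t \<in> {a..b}" "s \<le> t" for s t
    using mono_onD[OF assms(5) that] monotone_onD[OF assms(6) that]
    by (simp add: l1_dist_def assms(3,7))
  have dist_eq: "\<bar>\<phi> s - \<phi> t\<bar> = l1_dist (\<gamma> s) (\<gamma> t)"
    if "s \<in> {a..b}" "t \<in> {a..b}" for s t
    using dist_le[of s t] dist_le[of t s] that
    by (cases "s \<le> t") (auto simp: l1_dist_def abs_minus_commute)
  have "continuous_on {a..b} (\<lambda>t. fst (\<gamma> t))" "continuous_on {a..b} (\<lambda>t. snd (\<gamma> t))"
    using assms(4) by (auto intro!: continuous_intros)
  then have cont: "continuous_on {a..b} \<phi>"
    unfolding assms(3,7) by (auto intro!: continuous_intros)
  have "\<phi> ` {a..b} = {0..L}"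
  proof (intro equalityI subsetI)
    fix y assume "y \<in> \<phi> ` {a..b}"
    then obtain t where t: "t \<in> {a..b}" "y = \<phi> t" by blast
    have "f1 a \<le> f1 t" "f1 t \<le> f1 b" "f2 t \<le> f2 a" "f2 b \<le> f2 t"
      using t(1) assms(2) mono_onD[OF assms(5), of a t] mono_onD[OF assms(5), of t b]
        monotone_onD[OF assms(6), of a t] monotone_onD[OF assms(6), of t b] by auto
    then show "y \<in> {0..L}"
      by (simp add: t(2) assms(7,8))
  next
    \<comment> \<open>\<open>\<phi>\<close> is 0 at \<open>a\<close> and \<open>L\<close> at
      \<open>b\<close>, so continuity yields every value in between.\<close>
    fix y assume "y \<in> {0..L}"
    then show "y \<in> \<phi> ` {a..b}"
      using IVT'[of \<phi> a y b] cont assms(2,8) by (fastforce simp: assms(7))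
  qed
  then have iso: "isometry_onto l1_dist X dist {0..L} h"
    unfolding isometry_onto_def X_def using dist_eq by (simp add: image_image h\<gamma> dist_real_def)
  \<comment> \<open>\<open>\<phi>\<close> may be constant where \<open>\<gamma>\<close> rests;
    injectivity is a matter of points of the front, which \<open>l1_dist\<close> separates.\<close>
  have inj: "inj_on h X"
  proof (rule inj_onI)
    fix p q assume "p \<in> X" "q \<in> X" "h p = h q"
    then have "l1_dist p q = 0"
      using iso unfolding isometry_onto_def by fastforce
    then show "p = q"
      by (auto simp: l1_dist_def prod_eq_iff)
  qed
  have "(\<forall>T. T \<subseteq> X \<and> finite T \<and> card T = k \<longrightarrow> invertible_mat (sp_matrix \<beta> l1_dist T)) \<and>
      (\<exists>!S. sp_optimum \<beta> l1_dist X k S) \<and>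
      (\<forall>S. sp_optimum \<beta> l1_dist X k S \<longleftrightarrow>
        (\<exists>t. (\<forall>i\<in>{1..k}. t i \<in> {a..b} \<and> \<phi> (t i) = (real i - 1) * L / (real k - 1)) \<and>
             S = (\<lambda>i. \<gamma> (t i)) ` {1..k}))" if L: "L > 0" and k: "k \<ge> 2" for k
  proof -
    obtain n where n: "k = Suc n" "n > 0"
      using k by (cases k) auto
    define q where "q i = (real i - 1) * L / (real k - 1)" for i
    \<comment> \<open>Index shift: grid points are numbered from 0 to \<open>n\<close> in the lemmas
      and from 1 to \<open>k = n + 1\<close> in the theorem.\<close>
    have Q: "(\<lambda>i. real i * L / real n) ` {..n} = q ` {1..k}"
    proof -
      have "q ` {1..k} = q ` Suc ` {..n}"
        by (simp only: n(1) image_Suc_atMost)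
      then show ?thesis
        by (simp add: image_image q_def n)
    qed
    have opt: "sp_optimum \<beta> l1_dist X k S \<longleftrightarrow> S \<subseteq> X \<and> h ` S = q ` {1..k}" for S
      unfolding n(1) Q[unfolded n(1), symmetric]
      by (rule isometry_segment_sp_optimum[OF iso inj assms(1) L n(2)])
    \<comment> \<open>A point may have several parameters, so \<open>t\<close> picks one for each
      grid value; injectivity of \<open>h\<close> shows that the chosen points exhaust
      \<open>S\<close>.\<close>
    have param: "S \<subseteq> X \<and> h ` S = q ` {1..k} \<longleftrightarrow>
        (\<exists>t. (\<forall>i\<in>{1..k}. t i \<in> {a..b} \<and> \<phi> (t i) = q i) \<and> S = (\<lambda>i. \<gamma> (t i)) ` {1..k})" for S
    proof
      assume S: "S \<subseteq> X \<and> h ` S = q ` {1..k}"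
      have "\<exists>t. t \<in> {a..b} \<and> \<phi> t = q i \<and> \<gamma> t \<in> S" if "i \<in> {1..k}" for i
      proof -
        have "q i \<in> h ` S"
          using S that by blast
        then obtain p where p: "p \<in> S" "h p = q i"
          by auto
        then obtain t where "t \<in> {a..b}" "p = \<gamma> t"
          using S unfolding X_def by blast
        with p show ?thesis using h\<gamma> by metis
      qed
      then obtain t where t: "\<And>i. i \<in> {1..k} \<Longrightarrow> t i \<in> {a..b} \<and> \<phi> (t i) = q i \<and> \<gamma> (t i) \<in> S"
        by metis
      have img: "h ` (\<lambda>i. \<gamma> (t i)) ` {1..k} = h ` S"
      proof -
        have "h ` (\<lambda>i. \<gamma> (t i)) ` {1..k} = q ` {1..k}"
          unfolding image_image h\<gamma> using t by (intro image_cong) auto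
        then show ?thesis using S by simp
      qed
      have sub: "(\<lambda>i. \<gamma> (t i)) ` {1..k} \<subseteq> X"
        using t unfolding X_def by blast
      have "(\<lambda>i. \<gamma> (t i)) ` {1..k} = S"
        using inj_on_image_eq_iff[OF inj sub conjunct1[OF S]] img by (rule iffD1)
      then have "S = (\<lambda>i. \<gamma> (t i)) ` {1..k}"
        by (rule sym)
      with t show "\<exists>t. (\<forall>i\<in>{1..k}. t i \<in> {a..b} \<and> \<phi> (t i) = q i) \<and> S = (\<lambda>i. \<gamma> (t i)) ` {1..k}"
        by (intro exI[of _ t]) simp
    next
      assume "\<exists>t. (\<forall>i\<in>{1..k}. t i \<in> {a..b} \<and> \<phi> (t i) = q i) \<and> S = (\<lambda>i. \<gamma> (t i)) ` {1..k}"
      then show "S \<subseteq> X \<and> h ` S = q ` {1..k}"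
        by (auto simp: X_def image_image h\<gamma>)
    qed
    have "q i \<in> h ` X" if "i \<in> {1..k}" for i
    proof -
      have "(real i - 1) * L \<le> (real k - 1) * L"
        using that L by (intro mult_right_mono) auto
      then have "q i \<in> {0..L}"
        using that L k by (simp add: q_def divide_le_eq mult.commute)
      then show ?thesis
        using iso by (simp add: isometry_onto_def)
    qed
    then have "q ` {1..k} \<subseteq> h ` X"
      by blast
    then obtain R where R: "R \<subseteq> X" "h ` R = q ` {1..k}"
      unfolding subset_image_iff by metis
    \<comment> \<open>Uniqueness holds for the set, not for its parameters: an injective
      \<open>h\<close> determines a subset of \<open>X\<close> from its image.\<close>
    then have "\<exists>!S. S \<subseteq> X \<and> h ` S = q ` {1..k}"
      by (intro ex1I[of _ R]) (metis inj_on_image_eq_iff[OF inj])+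
    moreover have "invertible_mat (sp_matrix \<beta> l1_dist T)"
      if "T \<subseteq> X" "finite T" "card T = k" for T
      using isometry_segment_diversity(1)[OF iso inj assms(1) L n(2)] that n(1) by blast
    ultimately show ?thesis
      unfolding opt param[symmetric] q_def[symmetric] by blast
  qed
  note opt = this
  have "\<exists>h. (\<forall>t\<in>{a..b}. h (\<gamma> t) = \<phi> t) \<and> isometry_onto l1_dist X dist {0..L} h"
    using iso h\<gamma> by (intro exI[of _ h]) simp
  then show ?thesis
    unfolding X_def[symmetric] by (rule conjI) (intro impI allI opt)
qed

end
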